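(* Let $k\ge 2$, $q\ge1$ and let $\mathbf{v}\in W_{k,q}$ be a vertex of $T_{k,q}$ with $\mathrm{type}(\mathbf{v})=(\alpha_0;\alpha_1,\ldots,\alpha_{s-1};\alpha_s)$. Let $P_{\mathbf{v}}=C_{\alpha_0+\alpha_s+1}\times C_{\alpha_1}\times\cdots\times C_{\alpha_{s-1}}$ be the product of $s$ chains of lengths $\alpha_0+\alpha_s+1,\alpha_1,\ldots,\alpha_{s-1}$, and $\overline{P}_{\mathbf{v}}$ the poset obtained by removing its minimum and maximum. Then $\mathrm{link}_{T_{k,q}}(\mathbf{v})\cong\Delta(\overline{P}_{\mathbf{v}})$.
   Context: $R_{k,q}=\{\mathbf{x}\in\mathbb{R}^{k-1}:0\le x_1\le\cdots\le x_{k-1}\le q\}$, $W_{k,q}=R_{k,q}\cap\mathbb{Z}^{k-1}$. A permutation $\pi$ of $[k-1]$ is consistent with $\mathbf{v}\in W_{k,q}$ if $i$ precedes $i+1$ in $\pi$ whenever $v_i=v_{i+1}$; then $F(\mathbf{v},\pi)$ is the simplex with vertices $\mathbf{v}^{(1)}=\mathbf{v}$, $\mathbf{v}^{(m+1)}=\mathbf{v}^{(m)}+e_{\pi_{k-m}}$ ($m=1,\dots,k-1$). $T_{k,q}$ is the simplicial complex on $W_{k,q}$ whose facets are all such $F(\mathbf{v},\pi)$. The type of $\mathbf{v}$: $\alpha_0$ is the number of coordinates of $\mathbf{v}$ equal to $0$, $\alpha_s$ the number equal to $q$, and the coordinates strictly between $0$ and $q$ take $s-1$ distinct values whose multiplicities,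 in increasing order of value, are $\alpha_1,\ldots,\alpha_{s-1}$ (so $\alpha_0,\alpha_s\ge0$, $\alpha_i\ge1$ for $0<i<s$, and $\sum\alpha_i=k-1$). $C_m$ denotes the chain $0<1<\cdots<m$; products carry the componentwise order. $\Delta(P)$ is the order complex of $P$ (faces are chains); $\cong$ means isomorphism of simplicial complexes; $\mathrm{link}_K(\sigma)=\{\tau\in K:\sigma\cup\tau\in K,\sigma\cap\tau=\emptyset\}$. *)

theory Defs
  imports Complex_Main "HOL-Combinatorics.Permutations"
begin

section \<open>Abstract simplicial complexes\<close>

text \<open>A complex is given by its set of faces; the empty face is counted as a face.\<close>

type_synonym 'a complex_of = "'a set set"

definition vertices :: "'a complex_of \<Rightarrow> 'a set" where
  "vertices K = \<Union> K"

definition link :: "'a complex_of \<Rightarrow> 'a set \<Rightarrow> 'a complex_of" where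
  "link K \<sigma> = {\<tau> \<in> K. \<sigma> \<union> \<tau> \<in> K \<and> \<sigma> \<inter> \<tau> = {}}"

definition simplicial_iso :: "'a complex_of \<Rightarrow> 'b complex_of \<Rightarrow> bool" where
  "simplicial_iso K L \<longleftrightarrow>
     (\<exists>f. bij_betw f (vertices K) (vertices L) \<and>
          (\<forall>\<sigma>. \<sigma> \<subseteq> vertices K \<longrightarrow> (\<sigma> \<in> K \<longleftrightarrow> f ` \<sigma> \<in> L)))"

section \<open>Posets\<close>

definition order_complex :: "'a::order set \<Rightarrow> 'a complex_of" where
  "order_complex P = {C. C \<subseteq> P \<and> finite C \<and> Complete_Partial_Order.chain (\<le>) C}"

definition proper_part :: "'a::order set \<Rightarrow> 'a set" where
  "proper_part P = {x \<in> P. \<not> (\<forall>y\<in>P. x \<le> y) \<and> \<not> (\<forall>y\<in>P. y \<le> x)}"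

text \<open>The product of the chains \<open>{0,\<dots>,m}\<close>, one for each entry \<open>m\<close> of the list. A tuple is
  extended by zeros, so that the componentwise order is the order of the type \<open>nat \<Rightarrow> nat\<close>.\<close>

definition chain_product :: "nat list \<Rightarrow> (nat \<Rightarrow> nat) set" where
  "chain_product ms =
     {x. (\<forall>i < length ms. x i \<in> {..ms ! i}) \<and> (\<forall>i \<ge> length ms. x i = 0)}"

section \<open>The triangulation\<close>

text \<open>A vector with \<open>k - 1\<close> coordinates is a function on \<open>{1..k-1}\<close>, extended by zeros.\<close>

definition region :: "nat \<Rightarrow> real \<Rightarrow> (nat \<Rightarrow> real) set" where
  "region k q = {x. 0 \<le> x 1 \<and> (\<forall>i\<in>{1..<k-1}. x i \<le> x (i + 1)) \<and> x (k - 1) \<le> q \<and>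
                    (\<forall>i. i \<notin> {1..k-1} \<longrightarrow> x i = 0)}"

definition lattice_points :: "nat \<Rightarrow> int \<Rightarrow> (nat \<Rightarrow> int) set" where
  "lattice_points k q = {v. (\<lambda>i. real_of_int (v i)) \<in> region k (real_of_int q)}"

text \<open>A permutation \<open>\<pi>\<close> stands for the word \<open>\<pi> 1, \<dots>, \<pi> (k - 1)\<close>, so that \<open>inv \<pi> i\<close> is the
  position of \<open>i\<close> in it.\<close>

definition consistent :: "nat \<Rightarrow> (nat \<Rightarrow> int) \<Rightarrow> (nat \<Rightarrow> nat) \<Rightarrow> bool" where
  "consistent k v \<pi> \<longleftrightarrow> (\<forall>i\<in>{1..<k-1}. v i = v (i + 1) \<longrightarrow> inv \<pi> i < inv \<pi> (i + 1))"

definition unit_vec :: "nat \<Rightarrow> nat \<Rightarrow> int" where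
  "unit_vec i = (\<lambda>j. if j = i then 1 else 0)"

text \<open>Indices start from 0: \<open>simplex_vertex k v \<pi> m\<close> is \<open>v\<^sup>(\<^sup>m\<^sup>+\<^sup>1\<^sup>)\<close>.\<close>

primrec simplex_vertex ::
  "nat \<Rightarrow> (nat \<Rightarrow> int) \<Rightarrow> (nat \<Rightarrow> nat) \<Rightarrow> nat \<Rightarrow> (nat \<Rightarrow> int)" where
  "simplex_vertex k v \<pi> 0 = v"
| "simplex_vertex k v \<pi> (Suc m) =
     (\<lambda>j. simplex_vertex k v \<pi> m j + unit_vec (\<pi> (k - Suc m)) j)"

definition simplex :: "nat \<Rightarrow> (nat \<Rightarrow> int) \<Rightarrow> (nat \<Rightarrow> nat) \<Rightarrow> (nat \<Rightarrow> int) set" where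
  "simplex k v \<pi> = simplex_vertex k v \<pi> ` {0..k-1}"

text \<open>As a complex on the lattice points, the triangulation only has simplices all of whose
  vertices are lattice points of the region. For consistent \<open>\<pi>\<close> this excludes exactly those
  \<open>v\<close> whose last coordinate is \<open>q\<close>, for which \<open>simplex k v \<pi>\<close> leaves the region.\<close>

definition triangulation :: "nat \<Rightarrow> int \<Rightarrow> (nat \<Rightarrow> int) complex_of" where
  "triangulation k q =
     {\<sigma>. \<exists>v \<pi>. v \<in> lattice_points k q \<and> \<pi> permutes {1..k-1} \<and> consistent k v \<pi> \<and>
               simplex k v \<pi> \<subseteq> lattice_points k q \<and> \<sigma> \<subseteq> simplex k v \<pi>}"

definition multiplicity_of :: "nat \<Rightarrow> (nat \<Rightarrow> int) \<Rightarrow> int \<Rightarrow> nat" where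
  "multiplicity_of k v c = card {i \<in> {1..k-1}. v i = c}"

text \<open>The type \<open>(\<alpha>\<^sub>0; \<alpha>\<^sub>1, \<dots>, \<alpha>\<^sub>s\<^sub>-\<^sub>1; \<alpha>\<^sub>s)\<close>, its middle part being a list of length \<open>s - 1\<close>
  (possibly empty).\<close>

definition vertex_type :: "nat \<Rightarrow> int \<Rightarrow> (nat \<Rightarrow> int) \<Rightarrow> nat \<times> nat list \<times> nat" where
  "vertex_type k q v =
     (multiplicity_of k v 0,
      map (multiplicity_of k v) (sorted_list_of_set {c \<in> v ` {1..k-1}. 0 < c \<and> c < q}),
      multiplicity_of k v q)"

end

theory Submission
  imports Defs
begin

text \<open>The triangulation is the flag complex of the relation: \<open>x \<le> y \<le> x + 1\<close> or
  \<open>y \<le> x \<le> y + 1\<close>. Hence the link of \<open>v\<close> is the complex of cliques among the neighbours of \<open>v\<close>,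
  and it suffices to match this relation with comparability in the product of chains. A neighbour
  is \<open>v + 1\<^sub>S\<close> or \<open>v - 1 + 1\<^sub>S\<close> for a set \<open>S\<close> of coordinates. Recording the choice between
  the two by an extra index \<open>0\<close> makes neighbours correspond to sets, and adjacency to inclusion.
  The sets that occur are the nonempty proper subsets meeting each block of \<open>v\<close> in an upper set
  for a suitable linear order; the coordinates equal to \<open>0\<close>, the index \<open>0\<close> and the coordinates equal
  to \<open>q\<close> together form a single block, which has \<open>\<alpha>\<^sub>0 + \<alpha>\<^sub>s + 1\<close> elements. An upper set of a chain
  is given by its size.\<close>

section \<open>Upper sets of disjoint unions of chains\<close>

text \<open>Counting from the top gives the largest key rank 0, so an upper set of \<open>B\<close>
  becomes an initial segment of ranks.\<close>

definition rank_above :: "('a \<Rightarrow> nat) \<Rightarrow> 'a set \<Rightarrow> 'a \<Rightarrow> nat" where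
  "rank_above r B x = card {y \<in> B. r x < r y}"

text \<open>The rank is strictly antitone in \<open>r\<close>, hence injective, and no element
  counts itself, so all ranks stay below \<open>card B\<close>.\<close>

lemma bij_betw_rank_above:
  assumes "finite B" "inj_on r B"
  shows "bij_betw (rank_above r B) B {..<card B}"
proof -
  have less: "rank_above r B y < rank_above r B x" if "x \<in> B" "y \<in> B" "r x < r y" for x y
    unfolding rank_above_def using that \<open>finite B\<close> by (intro psubset_card_mono) auto
  have inj: "inj_on (rank_above r B) B"
    using less assms(2) by (metis inj_onI inj_on_eq_iff nat_neq_iff)
  have "rank_above r B x < card B" if "x \<in> B" for x
    unfolding rank_above_def using that \<open>finite B\<close> by (intro psubset_card_mono) auto
  then have "rank_above r B ` B \<subseteq> {..<card B}"
    by auto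
  then have "rank_above r B ` B = {..<card B}"
    using inj by (simp add: card_image card_subset_eq)
  with inj show ?thesis
    by (simp add: bij_betw_def)
qed

lemma card_rank_above_less:
  assumes "finite B" "inj_on r B" "m \<le> card B"
  shows "card {x \<in> B. rank_above r B x < m} = m"
proof -
  have b: "bij_betw (rank_above r B) B {..<card B}"
    using assms by (simp add: bij_betw_rank_above)
  have "rank_above r B ` {x \<in> B. rank_above r B x < m} = {..<card B} \<inter> {..<m}"
    using b by (auto simp: bij_betw_def image_iff)
  also have "\<dots> = {..<m}"
    using assms(3) by auto
  finally have "card (rank_above r B ` {x \<in> B. rank_above r B x < m}) = m"
    by simp
  moreover have "inj_on (rank_above r B) {x \<in> B. rank_above r B x < m}"
    using b by (auto simp: bij_betw_def inj_on_def)
  ultimately show ?thesis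
    by (simp add: card_image)
qed

text \<open>If \<open>x\<close> is in \<open>A\<close>, so is everything above it, and
  \<open>x\<close> is one element more; if not, all of \<open>A\<close> lies strictly above
  \<open>x\<close>.\<close>

lemma upper_set_iff_rank_above:
  assumes "finite B" "inj_on r B" "A \<subseteq> B" "x \<in> B"
    and upper: "\<And>a b. a \<in> A \<Longrightarrow> b \<in> B \<Longrightarrow> r a < r b \<Longrightarrow> b \<in> A"
  shows "x \<in> A \<longleftrightarrow> rank_above r B x < card A"
proof
  assume "x \<in> A"
  then have "{y \<in> B. r x < r y} \<subset> A"
    using upper by auto
  then show "rank_above r B x < card A"
    unfolding rank_above_def using assms by (meson finite_subset psubset_card_mono)
next
  assume "rank_above r B x < card A"
  show "x \<in> A"
  proof (rule ccontr)
    assume "x \<notin> A"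
    then have "A \<subseteq> {y \<in> B. r x < r y}"
      using assms by (smt (verit) inj_on_eq_iff linorder_neqE_nat mem_Collect_eq subset_iff)
    then have "card A \<le> rank_above r B x"
      unfolding rank_above_def using \<open>finite B\<close> by (intro card_mono) auto
    with \<open>rank_above r B x < card A\<close> show False
      by simp
  qed
qed

section \<open>Upper sets taken block by block\<close>

text \<open>The poset behind this is the disjoint union of the fibres of \<open>b\<close>, each
  ordered by the key \<open>r\<close>.\<close>

definition block_upsets :: "'a set \<Rightarrow> ('a \<Rightarrow> 'b) \<Rightarrow> ('a \<Rightarrow> nat) \<Rightarrow> 'a set set" where
  "block_upsets I b r =
     {S. S \<subseteq> I \<and> (\<forall>i\<in>S. \<forall>j\<in>I. b i = b j \<and> r i < r j \<longrightarrow> j \<in> S)}"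

text \<open>The zeros past the end of \<open>cs\<close> match the convention of
  \<open>chain_product\<close>.\<close>

definition block_count :: "('a \<Rightarrow> 'b) \<Rightarrow> 'b list \<Rightarrow> 'a set \<Rightarrow> nat \<Rightarrow> nat" where
  "block_count b cs S = (\<lambda>i. if i < length cs then card {x \<in> S. b x = cs ! i} else 0)"

text \<open>Upper sets of a single chain are nested, so in each block the sizes decide
  inclusion.\<close>

lemma block_count_le_iff:
  assumes "finite I" "inj_on r I" "b ` I \<subseteq> set cs"
    and S: "S \<in> block_upsets I b r" and T: "T \<in> block_upsets I b r"
  shows "block_count b cs S \<le> block_count b cs T \<longleftrightarrow> S \<subseteq> T"
proof
  assume le: "block_count b cs S \<le> block_count b cs T"
  show "S \<subseteq> T"
  proof (rule ccontr)
    assume "\<not> S \<subseteq> T"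
    then obtain x where x: "x \<in> S" "x \<notin> T"
      by auto
    have sub: "S \<subseteq> I" "T \<subseteq> I"
      using S T by (auto simp: block_upsets_def)
    with x assms(3) obtain i where i: "i < length cs" "cs ! i = b x"
      by (metis image_subset_iff in_set_conv_nth subsetD)
    \<comment> \<open>A member of \<open>T\<close> in the block of \<open>x\<close> lies above
      \<open>x\<close>, since otherwise \<open>T\<close> would contain \<open>x\<close>; upward
      closure then puts it in \<open>S\<close>.\<close>
    have "y \<in> S" if "y \<in> T" "b y = b x" for y
    proof (cases "r x < r y")
      case True
      with S x sub that show ?thesis
        by (auto simp: block_upsets_def)
    next
      case False
      moreover have "r x \<noteq> r y"
        using assms(2) x that sub by (metis inj_on_eq_iff subsetD)
      ultimately have "x \<in> T"
        using T x sub that by (auto simp: block_upsets_def)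
      with x show ?thesis
        by simp
    qed
    then have "{y \<in> T. b y = b x} \<subset> {y \<in> S. b y = b x}"
      using x by auto
    moreover have "finite {y \<in> S. b y = b x}"
      using sub \<open>finite I\<close> by (simp add: finite_subset)
    ultimately have "block_count b cs T i < block_count b cs S i"
      using i by (simp add: block_count_def psubset_card_mono)
    with le show False
      by (meson le_funD not_le)
  qed
next
  assume "S \<subseteq> T"
  moreover have "finite T"
    using T \<open>finite I\<close> by (auto simp: block_upsets_def finite_subset)
  ultimately show "block_count b cs S \<le> block_count b cs T"
    by (auto simp: block_count_def le_fun_def intro!: card_mono)
qed

lemma block_count_in_chain_product:
  assumes "finite I" "S \<subseteq> I"
  shows "block_count b cs S \<in> chain_product (map (\<lambda>c. card {x \<in> I. b x = c}) cs)"
  using assms by (auto simp: block_count_def chain_product_def intro!: card_mono)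

text \<open>Surjectivity: from the block \<open>cs ! i\<close> take the \<open>a i\<close> elements
  of largest key.\<close>

lemma chain_product_eq_block_count:
  assumes "finite I" "inj_on r I" "distinct cs"
    and a: "a \<in> chain_product (map (\<lambda>c. card {x \<in> I. b x = c}) cs)"
  shows "\<exists>S \<in> block_upsets I b r. block_count b cs S = a"
proof -
  define B where "B c = {x \<in> I. b x = c}" for c
  define S where "S = {x \<in> I. \<exists>i < length cs. cs ! i = b x \<and> rank_above r (B (b x)) x < a i}"
  have [simp]: "finite (B c)" "inj_on r (B c)" for c
    using assms(1,2) by (auto simp: B_def inj_on_def)
  have upper: "j \<in> S" if "i \<in> S" "j \<in> I" "b i = b j" "r i < r j" for i j
  proof -
    have "rank_above r (B (b j)) j \<le> rank_above r (B (b j)) i"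
      unfolding rank_above_def using that(4) by (intro card_mono) auto
    with that show ?thesis
      by (fastforce simp: S_def)
  qed
  have "S \<subseteq> I"
    by (auto simp: S_def)
  with upper have "S \<in> block_upsets I b r"
    unfolding block_upsets_def by blast
  moreover have "block_count b cs S i = a i" for i
  proof (cases "i < length cs")
    case True
    \<comment> \<open>As \<open>cs\<close> is distinct, \<open>i\<close> is the only index naming
      this block.\<close>
    have "{x \<in> S. b x = cs ! i} = {x \<in> B (cs ! i). rank_above r (B (cs ! i)) x < a i}"
      using True \<open>distinct cs\<close> by (auto simp: S_def B_def nth_eq_iff_index_eq)
    moreover have "a i \<le> card (B (cs ! i))"
      using a True by (auto simp: chain_product_def B_def)
    ultimately show ?thesis
      using True by (simp add: block_count_def card_rank_above_less)
  next
    case False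
    with a show ?thesis
      by (simp add: block_count_def chain_product_def)
  qed
  ultimately show ?thesis
    by blast
qed

text \<open>Counting is an order isomorphism onto the product, so it carries the extreme upper sets
  \<open>{}\<close> and \<open>I\<close> to the minimum and maximum that are removed.\<close>

lemma bij_betw_block_count_proper_part:
  assumes "finite I" "inj_on r I" "distinct cs" "b ` I \<subseteq> set cs"
  shows "bij_betw (block_count b cs) (block_upsets I b r - {{}, I})
           (proper_part (chain_product (map (\<lambda>c. card {x \<in> I. b x = c}) cs)))"
proof -
  let ?U = "block_upsets I b r" and ?f = "block_count b cs"
  let ?P = "chain_product (map (\<lambda>c. card {x \<in> I. b x = c}) cs)"
  note le = block_count_le_iff[OF assms(1,2,4)]
  have inj: "inj_on ?f ?U"
  proof (rule inj_onI)
    fix S T assume "S \<in> ?U" "T \<in> ?U" "?f S = ?f T"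
    then show "S = T"
      using le[of S T] le[of T S] by simp
  qed
  have ends: "{} \<in> ?U" "I \<in> ?U"
    by (auto simp: block_upsets_def)
  have sub: "S \<subseteq> I" if "S \<in> ?U" for S
    using that by (simp add: block_upsets_def)
  have im: "?f ` ?U = ?P"
  proof
    show "?f ` ?U \<subseteq> ?P"
      using block_count_in_chain_product[OF assms(1)] sub by blast
    show "?P \<subseteq> ?f ` ?U"
      using chain_product_eq_block_count[OF assms(1-3)] by blast
  qed
  have bot: "(\<forall>y\<in>?f ` ?U. ?f S \<le> y) \<longleftrightarrow> S = {}" if "S \<in> ?U" for S
    using that ends le[of S] by auto
  have top: "(\<forall>y\<in>?f ` ?U. y \<le> ?f S) \<longleftrightarrow> S = I" if "S \<in> ?U" for S
  proof
    assume "\<forall>y\<in>?f ` ?U. y \<le> ?f S"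
    then have "I \<subseteq> S"
      using that ends(2) le[of I S] by simp
    then show "S = I"
      using sub[OF that] by simp
  qed (use that sub le[of _ I] ends in simp)
  have proper: "?f S \<in> proper_part (?f ` ?U) \<longleftrightarrow> S \<noteq> {} \<and> S \<noteq> I" if "S \<in> ?U" for S
    unfolding proper_part_def mem_Collect_eq bot[OF that] top[OF that] using that by simp
  have "?f ` (?U - {{}, I}) = proper_part (?f ` ?U)"
  proof (intro subset_antisym subsetI)
    fix y assume "y \<in> ?f ` (?U - {{}, I})"
    then obtain S where "S \<in> ?U" "S \<noteq> {}" "S \<noteq> I" "y = ?f S"
      by blast
    with proper[of S] show "y \<in> proper_part (?f ` ?U)"
      by simp
  next
    fix y assume y: "y \<in> proper_part (?f ` ?U)"
    then obtain S where "S \<in> ?U" "y = ?f S"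
      unfolding proper_part_def by blast
    with y proper[of S] show "y \<in> ?f ` (?U - {{}, I})"
      by blast
  qed
  moreover have "inj_on ?f (?U - {{}, I})"
    using inj by (rule inj_on_subset) auto
  ultimately show ?thesis
    unfolding im by (simp add: bij_betw_def)
qed

section \<open>The triangulation is a flag complex\<close>

lemma lattice_points_iff:
  "v \<in> lattice_points k q \<longleftrightarrow>
     0 \<le> v 1 \<and> (\<forall>i\<in>{1..<k-1}. v i \<le> v (i + 1)) \<and> v (k - 1) \<le> q \<and>
     (\<forall>i. i \<notin> {1..k-1} \<longrightarrow> v i = 0)"
  by (simp add: lattice_points_def region_def)

lemma lattice_points_outside:
  assumes "v \<in> lattice_points k q"
  shows "v 0 = 0" and "\<not> j < k \<Longrightarrow> v j = 0"
proof -
  have outside: "i \<notin> {1..k-1} \<Longrightarrow> v i = 0" for i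
    using assms unfolding lattice_points_iff by blast
  show "v 0 = 0"
    by (rule outside) simp
  show "v j = 0" if "\<not> j < k"
    by (rule outside) (use that in auto)
qed

lemma lattice_points_mono:
  assumes "v \<in> lattice_points k q" "1 \<le> i" "i \<le> j" "j \<le> k - 1"
  shows "v i \<le> v j"
  using assms(3,4)
proof (induction j rule: dec_induct)
  case (step j)
  with assms(1,2) have "v j \<le> v (Suc j)"
    by (simp add: lattice_points_iff)
  with step show ?case
    by simp
qed simp

lemma lattice_points_bounds:
  assumes "v \<in> lattice_points k q" "0 \<le> q"
  shows "0 \<le> v i" "v i \<le> q"
proof -
  have "0 \<le> v i \<and> v i \<le> q"
  proof (cases "i \<in> {1..k-1}")
    case True
    then show ?thesis
      using lattice_points_mono[OF assms(1), of 1 i] lattice_points_mono[OF assms(1), of i "k - 1"]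
        assms(1) by (auto simp: lattice_points_iff)
  next
    case False
    with assms show ?thesis
      by (simp add: lattice_points_iff)
  qed
  then show "0 \<le> v i" "v i \<le> q"
    by auto
qed

text \<open>The difference \<open>y - x\<close> is a 0/1 vector; the relation is directed and not
  transitive.\<close>

definition near :: "(nat \<Rightarrow> int) \<Rightarrow> (nat \<Rightarrow> int) \<Rightarrow> bool" where
  "near x y \<longleftrightarrow> x \<le> y \<and> (\<forall>j. y j \<le> x j + 1)"

text \<open>The word is read from its end: \<open>m\<close> steps raise the letters at positions
  \<open>k-m\<close> to \<open>k-1\<close>, each once by injectivity.\<close>

lemma simplex_vertex_eq:
  assumes "inj \<pi>" "m < k"
  shows "simplex_vertex k v \<pi> m j = v j + of_bool (j \<in> \<pi> ` {k-m..<k})"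
  using assms(2)
proof (induction m)
  case (Suc m)
  have "{k - Suc m..<k} = insert (k - Suc m) {k-m..<k}"
    using Suc.prems by auto
  moreover have "\<pi> (k - Suc m) \<notin> \<pi> ` {k-m..<k}"
    using Suc.prems by (auto dest!: injD[OF assms(1)])
  ultimately show ?case
    using Suc by (auto simp: unit_vec_def)
qed simp

text \<open>The easy half of flagness: vertices of one simplex raise nested sets of coordinates over
  the same base.\<close>

lemma triangulation_imp_near:
  assumes "\<sigma> \<in> triangulation k q"
  shows "\<sigma> \<subseteq> lattice_points k q" "finite \<sigma>"
    and "\<And>x y. x \<in> \<sigma> \<Longrightarrow> y \<in> \<sigma> \<Longrightarrow> near x y \<or> near y x"
proof -
  obtain v \<pi> where \<pi>: "\<pi> permutes {1..k-1}" and sub: "simplex k v \<pi> \<subseteq> lattice_points k q"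
    and \<sigma>: "\<sigma> \<subseteq> simplex k v \<pi>"
    using assms by (auto simp: triangulation_def)
  then show "\<sigma> \<subseteq> lattice_points k q"
    by simp
  show "finite \<sigma>"
    using \<sigma> by (rule finite_subset) (simp add: simplex_def)
  have inj: "inj \<pi>"
    using \<pi> by (rule permutes_inj)
  have near: "near (simplex_vertex k v \<pi> m) (simplex_vertex k v \<pi> m')" if "m \<le> m'" "m' < k" for m m'
    using that by (auto simp: near_def le_fun_def simplex_vertex_eq[OF inj])
  show "near x y \<or> near y x" if "x \<in> \<sigma>" "y \<in> \<sigma>" for x y
  \<comment> \<open>For \<open>k = 0\<close> truncated subtraction leaves the single vertex
    \<open>v\<close>, which the range \<open>m' < k\<close> above does not cover.\<close>
  proof (cases "k = 0")
    case True
    with that \<sigma> have "x = y"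
      by (auto simp: simplex_def)
    then show ?thesis
      by (simp add: near_def)
  next
    case False
    from that \<sigma> have "x \<in> simplex k v \<pi>" "y \<in> simplex k v \<pi>"
      by auto
    then obtain m m' where "x = simplex_vertex k v \<pi> m" "y = simplex_vertex k v \<pi> m'"
      "m \<le> k - 1" "m' \<le> k - 1"
      unfolding simplex_def by (elim imageE) auto
    with False show ?thesis
      using near[of m m'] near[of m' m] by (cases "m \<le> m'") auto
  qed
qed

section \<open>From cliques to simplices\<close>

text \<open>The word lists \<open>1\<close> to \<open>n\<close> by increasing key.\<close>

lemma permutation_of_key:
  fixes key :: "nat \<Rightarrow> nat"
  assumes "inj_on key {1..n}"
  shows "\<exists>\<pi>. \<pi> permutes {1..n} \<and> (\<forall>j\<in>{1..n}. inv \<pi> j = n - rank_above key {1..n} j)"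
proof -
  let ?r = "rank_above key {1..n}"
  \<comment> \<open>\<open>p\<close> sends a letter to its position, so the permutation sought is
    \<open>inv p\<close>.\<close>
  define p where "p j = (if j \<in> {1..n} then n - ?r j else j)" for j
  have r: "bij_betw ?r {1..n} {..<n}"
    using bij_betw_rank_above[of "{1..n}" key] assms by simp
  have "bij_betw (\<lambda>i. n - i) {..<n} {1..n}"
    by (rule bij_betwI[where g = "\<lambda>i. n - i"]) auto
  with r have "bij_betw ((\<lambda>i. n - i) \<circ> ?r) {1..n} {1..n}"
    by (rule bij_betw_trans)
  then have "bij_betw p {1..n} {1..n}"
    by (rule iffD1[OF bij_betw_cong, rotated]) (simp add: p_def)
  then have p: "p permutes {1..n}"
    by (rule bij_imp_permutes) (auto simp: p_def)
  then have "inv (inv p) = p"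
    by (simp add: permutes_bij inv_inv_eq)
  with permutes_inv[OF p] show ?thesis
    by (intro exI[of _ "inv p"]) (auto simp: p_def)
qed

text \<open>Over the base \<open>w\<close> the chain becomes a nested family of coordinate sets.
  Sorting the coordinates by how many of these sets contain them makes every set a final segment of
  the word, hence every member a vertex of one simplex.\<close>

lemma near_chain_imp_triangulation:
  assumes k: "k \<ge> 2"
    and w: "w \<in> lattice_points k q" "w (k - 1) < q"
    and \<sigma>: "\<sigma> \<subseteq> lattice_points k q" "finite \<sigma>"
    and wx: "\<And>x. x \<in> \<sigma> \<Longrightarrow> near w x"
    and chain: "\<And>x y. x \<in> \<sigma> \<Longrightarrow> y \<in> \<sigma> \<Longrightarrow> x \<le> y \<or> y \<le> x"
  shows "\<sigma> \<in> triangulation k q"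
proof -
  let ?n = "k - 1"
  define A where "A x = {j \<in> {1..?n}. w j < x j}" for x :: "nat \<Rightarrow> int"
  have A_mono: "A x \<subseteq> A y" if "x \<le> y" for x y
    by (auto simp: A_def intro: less_le_trans[OF _ le_funD[OF that]])
  have x_eq: "x j = w j + of_bool (j \<in> A x)" if "x \<in> \<sigma>" for x j
  proof (cases "j \<in> {1..?n}")
    case True
    with wx[OF that] have "w j \<le> x j" "x j \<le> w j + 1"
      by (auto simp: near_def le_fun_def)
    with True show ?thesis
      by (auto simp: A_def)
  next
    case False
    with that \<sigma> w show ?thesis
      by (auto simp: lattice_points_iff A_def)
  qed
  define h where "h j = card {x \<in> \<sigma>. j \<in> A x}" for j
  \<comment> \<open>Coordinates raised in more members of the chain come later in the word; ties are broken
    by the index, as consistency demands.\<close>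
  define key where "key j = h j * k + j" for j
  \<comment> \<open>An index below \<open>k\<close> cannot outweigh one unit of \<open>h\<close>, so
    the key compares lexicographically.\<close>
  have key_less: "key i < key j" if "i < k" "h i < h j" for i j
  proof -
    have "key i < (h i + 1) * k"
      using that by (simp add: key_def)
    also have "\<dots> \<le> h j * k"
      using that by (intro mult_right_mono) auto
    finally show ?thesis
      by (simp add: key_def)
  qed
  have inj: "inj_on key {1..?n}"
  proof (rule inj_onI)
    fix i j assume "i \<in> {1..?n}" "j \<in> {1..?n}" "key i = key j"
    moreover from this k have "i < k" "j < k"
      by auto
    ultimately have "h i = h j"
      using key_less[of i j] key_less[of j i] by (metis less_irrefl linorder_neqE_nat)
    with \<open>key i = key j\<close> show "i = j"
      by (simp add: key_def)
  qed
  let ?r = "rank_above key {1..?n}"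
  obtain \<pi> where \<pi>: "\<pi> permutes {1..?n}" and inv: "\<And>j. j \<in> {1..?n} \<Longrightarrow> inv \<pi> j = ?n - ?r j"
    using permutation_of_key[OF inj] by blast
  have inj\<pi>: "inj \<pi>"
    using \<pi> by (rule permutes_inj)
  have r_lt: "?r j < ?n" if "j \<in> {1..?n}" for j
    using bij_betw_rank_above[OF _ inj] that by (auto simp: bij_betw_def)
  have vertex: "simplex_vertex k w \<pi> m j = w j + of_bool (j \<in> {1..?n} \<and> ?r j < m)" if "m < k" for m j
  proof -
    have "j \<in> \<pi> ` {k-m..<k} \<longleftrightarrow> inv \<pi> j \<in> {k-m..<k}"
      using \<pi> by (metis image_iff permutes_inverses(1,2))
    \<comment> \<open>As \<open>?n = k - 1\<close>, a position of at least \<open>k - m\<close>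
      means a rank of at most \<open>m - 1\<close>.\<close>
    also have "\<dots> \<longleftrightarrow> j \<in> {1..?n} \<and> ?r j < m"
    proof (cases "j \<in> {1..?n}")
      case True
      with that inv[OF True] r_lt[OF True] show ?thesis
        by auto
    next
      case False
      then have "inv \<pi> j = j"
        using \<pi> by (meson permutes_inv permutes_not_in)
      with False that show ?thesis
        by auto
    qed
    finally show ?thesis
      using simplex_vertex_eq[OF inj\<pi> that] by simp
  qed
  \<comment> \<open>Members of \<sigma> are weakly increasing, so at a tie of \<open>w\<close>
    raising \<open>i\<close> forces raising \<open>i + 1\<close>. This yields both consistency and
    monotone vertices.\<close>
  have r_step: "?r (i + 1) < ?r i" if "i \<in> {1..<?n}" "w i = w (i + 1)" for i
  proof -
    have "i + 1 \<in> A x" if "x \<in> \<sigma>" "i \<in> A x" for x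
    proof -
      have "x i \<le> x (i + 1)"
        using that(1) \<sigma>(1) \<open>i \<in> {1..<?n}\<close> by (auto simp: lattice_points_iff)
      then show ?thesis
        using that \<open>i \<in> {1..<?n}\<close> \<open>w i = w (i + 1)\<close> by (auto simp: A_def)
    qed
    then have "h i \<le> h (i + 1)"
      unfolding h_def using \<sigma>(2) by (intro card_mono) auto
    then have "key i < key (i + 1)"
      unfolding key_def by (intro add_le_less_mono mult_le_mono1) auto
    then show ?thesis
      unfolding rank_above_def using that by (intro psubset_card_mono psubsetI) (auto dest: less_trans)
  qed
  have "consistent k w \<pi>"
    unfolding consistent_def
  proof (intro ballI impI)
    fix i assume i: "i \<in> {1..<?n}" "w i = w (i + 1)"
    then have mem: "i \<in> {1..?n}" "i + 1 \<in> {1..?n}"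
      by auto
    show "inv \<pi> i < inv \<pi> (i + 1)"
      using r_step[OF i] inv[OF mem(1)] inv[OF mem(2)] r_lt[OF mem(1)] by arith
  qed
  \<comment> \<open>A strict ascent of integers leaves room for a raise on its left, ties are
    settled by \<open>r_step\<close>, and \<open>w (k - 1) < q\<close> leaves room at the upper
    wall.\<close>
  moreover have "simplex k w \<pi> \<subseteq> lattice_points k q"
  proof -
    have "simplex_vertex k w \<pi> m \<in> lattice_points k q" if "m < k" for m
      unfolding lattice_points_iff vertex[OF that]
    proof (intro conjI ballI allI impI)
      fix i assume i: "i \<in> {1..<?n}"
      then have "w i \<le> w (i + 1)"
        using w by (simp add: lattice_points_iff)
      moreover have "?r i < m \<longrightarrow> ?r (i + 1) < m" if "w i = w (i + 1)"
        using r_step[OF i that] by simp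
      ultimately show "w i + of_bool (i \<in> {1..?n} \<and> ?r i < m)
          \<le> w (i + 1) + of_bool (i + 1 \<in> {1..?n} \<and> ?r (i + 1) < m)"
        using i by (cases "w i = w (i + 1)") auto
    qed (use w in \<open>auto simp: lattice_points_iff\<close>)
    with k show ?thesis
      by (auto simp: simplex_def)
  qed
  moreover have "\<sigma> \<subseteq> simplex k w \<pi>"
  proof
    fix x assume x: "x \<in> \<sigma>"
    have upper: "j \<in> A x" if "i \<in> A x" "j \<in> {1..?n}" "key i < key j" for i j
    proof (rule ccontr)
      assume j: "j \<notin> A x"
      \<comment> \<open>A member raising \<open>j\<close> is not below \<open>x\<close>, so it is
        above \<open>x\<close> and raises \<open>i\<close> too; \<open>x\<close> itself makes the
        count strict.\<close>
      have "i \<in> A y" if "y \<in> \<sigma>" "j \<in> A y" for y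
        using chain[OF x that(1)] A_mono that j \<open>i \<in> A x\<close> by blast
      then have "{y \<in> \<sigma>. j \<in> A y} \<subset> {y \<in> \<sigma>. i \<in> A y}"
        using j x that(1) by auto
      then have "h j < h i"
        unfolding h_def using \<sigma>(2) by (intro psubset_card_mono) auto
      moreover have "j < k"
        using that(2) k by auto
      ultimately show False
        using key_less[of j i] that(3) by simp
    qed
    have "card (A x) \<le> card {1..?n}"
      by (rule card_mono) (auto simp: A_def)
    then have m: "card (A x) < k"
      using k by simp
    have sub: "A x \<subseteq> {1..?n}"
      by (auto simp: A_def)
    have "j \<in> A x \<longleftrightarrow> j \<in> {1..?n} \<and> ?r j < card (A x)" for j
    proof (cases "j \<in> {1..?n}")
      case True
      then show ?thesis
        using upper_set_iff_rank_above[OF finite_atLeastAtMost inj sub True upper] by simp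
    next
      case False
      with sub show ?thesis
        by blast
    qed
    then have "x = simplex_vertex k w \<pi> (card (A x))"
      by (intro ext) (simp only: vertex[OF m] x_eq[OF x])
    with m show "x \<in> simplex k w \<pi>"
      unfolding simplex_def by auto
  qed
  ultimately show ?thesis
    using w \<pi> by (auto simp: triangulation_def)
qed

text \<open>The hard half of flagness: a clique is a chain, and its least member yields a base for
  the previous construction.\<close>

lemma near_clique_imp_triangulation:
  assumes k: "k \<ge> 2" and q: "q \<ge> 1"
    and \<sigma>: "\<sigma> \<subseteq> lattice_points k q" "finite \<sigma>" "\<sigma> \<noteq> {}"
    and clique: "\<And>x y. x \<in> \<sigma> \<Longrightarrow> y \<in> \<sigma> \<Longrightarrow> near x y \<or> near y x"
  shows "\<sigma> \<in> triangulation k q"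
proof -
  obtain m where m: "m \<in> \<sigma>" "\<And>x. x \<in> \<sigma> \<Longrightarrow> x \<le> m \<Longrightarrow> m = x"
    using finite_has_minimal[OF \<sigma>(2,3)] by metis
  \<comment> \<open>Members are pairwise comparable, so a minimal one is below all others.\<close>
  have mx: "near m x" if "x \<in> \<sigma>" for x
    using clique[OF m(1) that] m(2)[OF that] clique[OF m(1) m(1)] by (auto simp: near_def)
  have mW: "m \<in> lattice_points k q"
    using m(1) \<sigma>(1) by auto
  note bounds = lattice_points_bounds[where q = q]
  \<comment> \<open>The simplex based at the minimum leaves the region when the last coordinate is
    already \<open>q\<close>; lowering all coordinates equal to \<open>q\<close> cures this.\<close>
  define w where "w j = (if m j = q then q - 1 else m j)" for j
  have mq: "m j \<le> q" "0 \<le> m j" for j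
    using bounds[OF mW] q by auto
  have "w \<in> lattice_points k q"
    unfolding lattice_points_iff
  proof (intro conjI ballI allI impI)
    fix i assume "i \<in> {1..<k-1}"
    then have "m i \<le> m (i + 1)"
      using mW by (simp add: lattice_points_iff)
    then show "w i \<le> w (i + 1)"
      using mq[of "i + 1"] mq[of i] by (auto simp: w_def)
  qed (use mW mq q in \<open>auto simp: w_def lattice_points_iff\<close>)
  moreover have "w (k - 1) < q"
    using mq[of "k - 1"] by (auto simp: w_def)
  \<comment> \<open>Where \<open>m\<close> equals \<open>q\<close>, so does every member, which is
    one more than the lowered base.\<close>
  moreover have "near w x" if "x \<in> \<sigma>" for x
  proof -
    have "w j \<le> x j \<and> x j \<le> w j + 1" for j
    proof -
      have "m j \<le> x j" "x j \<le> m j + 1" "x j \<le> q"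
        using mx[OF that] bounds that \<sigma>(1) q by (auto simp: near_def le_fun_def)
      then show ?thesis
        by (auto simp: w_def)
    qed
    then show ?thesis
      by (simp add: near_def le_fun_def)
  qed
  moreover have "x \<le> y \<or> y \<le> x" if "x \<in> \<sigma>" "y \<in> \<sigma>" for x y
    using clique[OF that] by (auto simp: near_def)
  ultimately show ?thesis
    using near_chain_imp_triangulation[OF k] \<sigma> by blast
qed

section \<open>The neighbours of a vertex\<close>

definition neighbours :: "nat \<Rightarrow> int \<Rightarrow> (nat \<Rightarrow> int) \<Rightarrow> (nat \<Rightarrow> int) set" where
  "neighbours k q v = {w \<in> lattice_points k q. w \<noteq> v \<and> (near v w \<or> near w v)}"

text \<open>By flagness, \<sigma> is in the link when adding \<open>v\<close> to it gives a clique,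
  that is, when \<sigma> is a clique of neighbours.\<close>

lemma link_eq_cliques:
  assumes "k \<ge> 2" "q \<ge> 1" "v \<in> lattice_points k q"
  shows "link (triangulation k q) {v} =
           {\<sigma>. \<sigma> \<subseteq> neighbours k q v \<and> finite \<sigma> \<and> (\<forall>x\<in>\<sigma>. \<forall>y\<in>\<sigma>. near x y \<or> near y x)}"
proof (intro set_eqI iffI)
  fix \<sigma> assume "\<sigma> \<in> link (triangulation k q) {v}"
  then have "{v} \<union> \<sigma> \<in> triangulation k q" "v \<notin> \<sigma>"
    by (auto simp: link_def)
  with triangulation_imp_near[OF this(1)]
  show "\<sigma> \<in> {\<sigma>. \<sigma> \<subseteq> neighbours k q v \<and> finite \<sigma> \<and> (\<forall>x\<in>\<sigma>. \<forall>y\<in>\<sigma>. near x y \<or> near y x)}"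
    by (auto simp: neighbours_def)
next
  fix \<sigma>
  assume \<sigma>: "\<sigma> \<in> {\<sigma>. \<sigma> \<subseteq> neighbours k q v \<and> finite \<sigma> \<and> (\<forall>x\<in>\<sigma>. \<forall>y\<in>\<sigma>. near x y \<or> near y x)}"
  have "near v v"
    by (simp add: near_def)
  with \<sigma> assms(3) have "{v} \<union> \<sigma> \<in> triangulation k q"
    by (intro near_clique_imp_triangulation[OF assms(1,2)]) (auto simp: neighbours_def)
  moreover from this have "\<sigma> \<in> triangulation k q"
    by (auto simp: triangulation_def)
  ultimately show "\<sigma> \<in> link (triangulation k q) {v}"
    using \<sigma> by (auto simp: link_def neighbours_def)
qed

text \<open>Index \<open>0\<close> plays the role of the wall of the region: it is raised exactly by the neighbours
  not above \<open>v\<close>, which are then compared with \<open>v\<close> after adding the all-ones vector.\<close>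

definition raised_set :: "nat \<Rightarrow> (nat \<Rightarrow> int) \<Rightarrow> (nat \<Rightarrow> int) \<Rightarrow> nat set" where
  "raised_set k v w = {j. j < k \<and> v j < w j + of_bool (\<not> v \<le> w)}"

text \<open>The intended inverse of \<open>raised_set\<close>; at index 0 the two indicators cancel,
  so the entry stays \<open>v 0\<close>.\<close>

definition raise :: "nat \<Rightarrow> (nat \<Rightarrow> int) \<Rightarrow> nat set \<Rightarrow> nat \<Rightarrow> int" where
  "raise k v S = (\<lambda>j. if j < k then v j + of_bool (j \<in> S) - of_bool (0 \<in> S) else 0)"

text \<open>Since \<open>v 0 = 0\<close>, the block of the index \<open>0\<close> consists of \<open>0\<close> and all coordinates equal to
  \<open>0\<close> or \<open>q\<close>. By the key below the coordinates equal to \<open>0\<close> are raised first, then the index \<open>0\<close>,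
  then the coordinates equal to \<open>q\<close>.\<close>

definition block :: "int \<Rightarrow> (nat \<Rightarrow> int) \<Rightarrow> nat \<Rightarrow> int" where
  "block q v j = v j mod q"

definition block_key :: "nat \<Rightarrow> int \<Rightarrow> (nat \<Rightarrow> int) \<Rightarrow> nat \<Rightarrow> nat" where
  "block_key k q v j = (if v j = q then j else k + j)"

abbreviation raisable :: "nat \<Rightarrow> int \<Rightarrow> (nat \<Rightarrow> int) \<Rightarrow> nat set set" where
  "raisable k q v \<equiv> block_upsets {..<k} (block q v) (block_key k q v)"

lemma inj_block_key: "inj_on (block_key k q v) {..<k}"
  by (auto simp: inj_on_def block_key_def split: if_splits)

text \<open>Between 0 and \<open>q\<close>, reduction modulo \<open>q\<close> identifies only the
  two walls.\<close>

lemma block_eq_cases: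
  assumes "v \<in> lattice_points k q" "q \<ge> 1" "block q v i = block q v j"
  shows "v i = v j \<or> v i = 0 \<and> v j = q \<or> v i = q \<and> v j = 0"
proof -
  have "0 \<le> v i" "v i \<le> q" "0 \<le> v j" "v j \<le> q"
    using assms lattice_points_bounds[of v k q] by auto
  with assms show ?thesis
    unfolding block_def by (smt (verit) mod_pos_pos_trivial mod_self)
qed

lemma raise_raised_set:
  assumes v: "v \<in> lattice_points k q" and w: "w \<in> neighbours k q v"
  shows "raise k v (raised_set k v w) = w"
proof
  fix j
  have z: "w j = 0" if "\<not> j < k" 
    using that w lattice_points_outside(2) unfolding neighbours_def by blast
  have "v 0 = 0" "w 0 = 0"
    using v w lattice_points_outside(1) unfolding neighbours_def by blast+
  \<comment> \<open>Both vectors vanish at index 0, so only the all-ones correction can put 0 into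
    the set.\<close>
  then have "0 \<in> raised_set k v w \<longleftrightarrow> 0 < k \<and> \<not> v \<le> w"
    by (auto simp: raised_set_def)
  moreover have "v j \<le> w j \<and> w j \<le> v j + 1" if "v \<le> w"
  proof -
    have "near v w"
      using w that by (auto simp: neighbours_def near_def)
    then show ?thesis
      by (simp add: near_def le_fun_def)
  qed
  moreover have "w j \<le> v j \<and> v j \<le> w j + 1" if "\<not> v \<le> w"
    using w that by (auto simp: neighbours_def near_def le_fun_def)
  ultimately show "raise k v (raised_set k v w) j = w j"
    using z by (auto simp: raise_def raised_set_def)
qed

text \<open>An index outside \<open>S\<close> drops below \<open>v\<close> once the all-ones vector
  is subtracted, so 0 can be recovered from the result. The full set would give back
  \<open>v\<close>, whose raised set is empty.\<close>

lemma raised_set_raise: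
  assumes k: "k > 0" and v: "v \<in> lattice_points k q" and S: "S \<subseteq> {..<k}" "S \<noteq> {..<k}"
  shows "raised_set k v (raise k v S) = S"
proof -
  note z = lattice_points_outside(2)[OF v]
  have "v \<le> raise k v S \<longleftrightarrow> 0 \<notin> S"
  proof
    assume le: "v \<le> raise k v S"
    obtain j where "j < k" "j \<notin> S"
      using S by auto
    with le show "0 \<notin> S"
      by (auto simp: raise_def le_fun_def dest!: spec[of _ j])
  qed (use z in \<open>auto simp: raise_def le_fun_def\<close>)
  with S show ?thesis
    by (auto simp: raised_set_def raise_def)
qed

text \<open>Upward closure excludes each way of leaving the region: from index 0 to 1 at the wall 0,
  from \<open>k - 1\<close> to 0 at the wall \<open>q\<close>, and from \<open>i\<close> to
  \<open>i + 1\<close> at a tie.\<close>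

lemma raise_in_neighbours:
  assumes k: "k \<ge> 2" and q: "q \<ge> 1" and v: "v \<in> lattice_points k q"
    and S: "S \<in> raisable k q v" "S \<noteq> {}" "S \<noteq> {..<k}"
  shows "raise k v S \<in> neighbours k q v"
proof -
  have sub: "S \<subseteq> {..<k}"
    and up: "\<And>i j. i \<in> S \<Longrightarrow> j < k \<Longrightarrow> block q v i = block q v j \<Longrightarrow>
               block_key k q v i < block_key k q v j \<Longrightarrow> j \<in> S"
    using S by (auto simp: block_upsets_def)
  note v0 = lattice_points_outside(1)[OF v] and z = lattice_points_outside(2)[OF v]
  have vb: "0 \<le> v j" "v j \<le> q" for j
    using lattice_points_bounds[OF v] q by auto
  have "raise k v S \<in> lattice_points k q"
    unfolding lattice_points_iff
  proof (intro conjI ballI allI impI)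
    have "0 \<in> S \<and> v 1 = 0 \<longrightarrow> 1 \<in> S"
      using up[of 0 1] v0 k q by (simp add: block_def block_key_def)
    moreover have "v 1 = 0 \<or> 1 \<le> v 1"
      using vb(1)[of 1] by linarith
    ultimately show "0 \<le> raise k v S 1"
      using k by (auto simp: raise_def)
    have "0 \<notin> S \<and> v (k - 1) = q \<longrightarrow> k - 1 \<notin> S"
      using up[of "k - 1" 0] v0 k q by (auto simp: block_def block_key_def)
    moreover have "v (k - 1) = q \<or> v (k - 1) + 1 \<le> q"
      using vb(2)[of "k - 1"] by linarith
    ultimately show "raise k v S (k - 1) \<le> q"
      using k vb(2)[of "k - 1"] by (auto simp: raise_def)
    fix i assume i: "i \<in> {1..<k-1}"
    then have "v i \<le> v (i + 1)"
      using v by (simp add: lattice_points_iff)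
    moreover have "i \<in> S \<and> v i = v (i + 1) \<longrightarrow> i + 1 \<in> S"
      using up[of i "i + 1"] i by (auto simp: block_def block_key_def)
    ultimately show "raise k v S i \<le> raise k v S (i + 1)"
      using i by (cases "v i = v (i + 1)") (auto simp: raise_def)
  next
    fix i assume "i \<notin> {1..k-1}"
    then have "i = 0 \<or> \<not> i < k"
      using k by auto
    then show "raise k v S i = 0"
      using v0 k by (auto simp: raise_def)
  qed
  moreover have "raise k v S \<noteq> v"
  proof
    assume "raise k v S = v"
    then have "raised_set k v v = S"
      using raised_set_raise[of k v q S] k v sub S by simp
    with S show False
      by (auto simp: raised_set_def)
  qed
  moreover have "near v (raise k v S) \<or> near (raise k v S) v"
    using z by (cases "0 \<in> S") (auto simp: near_def le_fun_def raise_def)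
  ultimately show ?thesis
    by (simp add: neighbours_def)
qed

text \<open>Conversely, monotonicity and the walls, applied to \<open>w\<close>, force upward
  closure.\<close>

lemma raised_set_in_raisable:
  assumes q: "q \<ge> 1" and v: "v \<in> lattice_points k q" and w: "w \<in> neighbours k q v"
  shows "raised_set k v w \<in> raisable k q v"
proof -
  have wW: "w \<in> lattice_points k q"
    using w by (simp add: neighbours_def)
  note v0 = lattice_points_outside(1)[OF v] lattice_points_outside(1)[OF wW]
  have wb: "0 \<le> w j" "w j \<le> q" for j
    using lattice_points_bounds[OF wW] q by auto
  have "j \<in> raised_set k v w"
    if i: "i \<in> raised_set k v w" and j: "j < k" and b: "block q v i = block q v j"
      and key: "block_key k q v i < block_key k q v j" for i j
  proof -
    have ik: "i < k"
      using i by (simp add: raised_set_def)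
    have "\<not> (v i = 0 \<and> v j = q)"
      using key j q by (auto simp: block_key_def)
    with block_eq_cases[OF v q b] consider "v i = v j" "i < j" | "v i = q" "v j = 0" "v i \<noteq> v j"
      using key by (auto simp: block_key_def split: if_splits)
    then show ?thesis
    proof cases
      case 1
      \<comment> \<open>Monotonicity only covers indices from 1 on; index 0 is raised only when the
        correction is present.\<close>
      have "w i \<le> w j \<or> i = 0 \<and> \<not> v \<le> w"
      proof (cases "i = 0")
        case True
        with i v0 show ?thesis
          by (auto simp: raised_set_def)
      next
        case False
        with 1 j show ?thesis
          using lattice_points_mono[OF wW, of i j] by auto
      qed
      with 1 i j v0 wb[of j] show ?thesis
        by (auto simp: raised_set_def)
    next
      case 2
      \<comment> \<open>Since \<open>w i\<close> is at most \<open>q\<close>, index \<open>i\<close>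
        is raised only through the correction, which also raises every index where \<open>v\<close>
        is 0.\<close>
      have "\<not> v \<le> w"
        using i 2 wb[of i] by (auto simp: raised_set_def)
      with 2 j wb[of j] show ?thesis
        by (auto simp: raised_set_def)
    qed
  qed
  then show ?thesis
    by (auto simp: block_upsets_def raised_set_def)
qed

text \<open>Exactly \<open>{}\<close> and \<open>{..<k}\<close> are left out because
  \<open>raise\<close> sends both to \<open>v\<close> itself.\<close>

lemma bij_betw_raised_set:
  assumes k: "k \<ge> 2" and q: "q \<ge> 1" and v: "v \<in> lattice_points k q"
  shows "bij_betw (raised_set k v) (neighbours k q v) (raisable k q v - {{}, {..<k}})"
proof (rule bij_betwI[where g = "raise k v"])
  have ends: "raise k v {} = v" "raise k v {..<k} = v"
    using k lattice_points_outside(2)[OF v] by (auto simp: raise_def)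
  have "raised_set k v w \<notin> {{}, {..<k}}" if "w \<in> neighbours k q v" for w
  proof
    assume "raised_set k v w \<in> {{}, {..<k}}"
    then consider "raised_set k v w = {}" | "raised_set k v w = {..<k}"
      by blast
    then have "raise k v (raised_set k v w) = v"
      using ends by cases simp_all
    with raise_raised_set[OF v that] that show False
      by (simp add: neighbours_def)
  qed
  then show "raised_set k v \<in> neighbours k q v \<rightarrow> raisable k q v - {{}, {..<k}}"
    using raised_set_in_raisable[OF q v] by blast
  show "raise k v \<in> raisable k q v - {{}, {..<k}} \<rightarrow> neighbours k q v"
    using raise_in_neighbours[OF k q v] by blast
  show "raise k v (raised_set k v w) = w" if "w \<in> neighbours k q v" for w
    using raise_raised_set[OF v that] .
  show "raised_set k v (raise k v S) = S" if "S \<in> raisable k q v - {{}, {..<k}}" for S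
  proof (rule raised_set_raise[OF _ v])
    show "S \<subseteq> {..<k}" "S \<noteq> {..<k}"
      using that unfolding block_upsets_def by blast+
  qed (use k in simp)
qed

section \<open>Adjacency as inclusion\<close>

text \<open>If 0 is in both sets or in neither, the difference is the indicator of
  \<open>T - S\<close>. If 0 is only in \<open>T\<close>, then \<open>raise k v T\<close> is the
  lower vector, and the difference indicates \<open>S\<close> together with the complement of
  \<open>T\<close>.\<close>

lemma near_raise_if_subset:
  assumes "S \<subseteq> T"
  shows "near (raise k v S) (raise k v T) \<or> near (raise k v T) (raise k v S)"
proof (cases "0 \<in> T \<longrightarrow> 0 \<in> S")
  case True
  with \<open>S \<subseteq> T\<close> have "near (raise k v S) (raise k v T)"
    by (auto simp: near_def le_fun_def raise_def)
  then show ?thesis ..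
next
  case False
  with \<open>S \<subseteq> T\<close> have "near (raise k v T) (raise k v S)"
    by (auto simp: near_def le_fun_def raise_def)
  then show ?thesis ..
qed

text \<open>If the sets agree at 0, the lower bound gives \<open>S \<subseteq> T\<close>; if 0 is
  only in \<open>S\<close>, the upper bound gives \<open>T \<subseteq> S\<close>.\<close>

lemma near_raise_imp_comparable:
  assumes S: "S \<subseteq> {..<k}" "S \<noteq> {}" and T: "T \<subseteq> {..<k}" "T \<noteq> {..<k}"
    and near: "near (raise k v S) (raise k v T)"
  shows "S \<subseteq> T \<or> T \<subseteq> S"
proof -
  have le: "of_bool (j \<in> S) - of_bool (0 \<in> S) \<le> of_bool (j \<in> T) - (of_bool (0 \<in> T) :: int)"
    and le1: "of_bool (j \<in> T) - of_bool (0 \<in> T) \<le> of_bool (j \<in> S) - of_bool (0 \<in> S) + (1 :: int)"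
    if "j < k" for j
  proof -
    have "raise k v S j \<le> raise k v T j" "raise k v T j \<le> raise k v S j + 1"
      using near by (simp_all add: near_def le_fun_def)
    with that show "of_bool (j \<in> S) - of_bool (0 \<in> S) \<le> of_bool (j \<in> T) - (of_bool (0 \<in> T) :: int)"
      and "of_bool (j \<in> T) - of_bool (0 \<in> T) \<le> of_bool (j \<in> S) - of_bool (0 \<in> S) + (1 :: int)"
      by (simp_all add: raise_def)
  qed
  consider "0 \<in> S \<longleftrightarrow> 0 \<in> T" | "0 \<in> S" "0 \<notin> T" | "0 \<notin> S" "0 \<in> T"
    by blast
  then show ?thesis
  proof cases
    case 1
    have "j \<in> T" if "j \<in> S" for j
    proof -
      have "j < k"
        using that S by blast
      then show ?thesis
        using le[of j] 1 that by (simp add: of_bool_def split: if_splits)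
    qed
    then show ?thesis
      by blast
  next
    case 2
    have "j \<in> S" if "j \<in> T" for j
    proof -
      have "j < k"
        using that T by blast
      then show ?thesis
        using le1[of j] 2 that by (simp add: of_bool_def split: if_splits)
    qed
    then show ?thesis
      by blast
  next
    case 3
    \<comment> \<open>Here \<open>raise k v T \<le> v \<le> raise k v S\<close>, so both are \<open>v\<close>.\<close>
    have "j \<notin> S" if "j < k" for j
      using le[OF that] 3 by (simp add: of_bool_def split: if_splits)
    with S show ?thesis
      by blast
  qed
qed

lemma near_iff_raised_set_comparable:
  assumes k: "k \<ge> 2" and q: "q \<ge> 1" and v: "v \<in> lattice_points k q"
    and x: "x \<in> neighbours k q v" and y: "y \<in> neighbours k q v"
  shows "near x y \<or> near y x \<longleftrightarrow>
           raised_set k v x \<subseteq> raised_set k v y \<or> raised_set k v y \<subseteq> raised_set k v x"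
proof -
  have R: "raised_set k v w \<subseteq> {..<k} \<and> raised_set k v w \<noteq> {} \<and> raised_set k v w \<noteq> {..<k}"
    if "w \<in> neighbours k q v" for w
    using bij_betwE[OF bij_betw_raised_set[OF k q v]] that by (auto simp: block_upsets_def)
  show ?thesis
    using near_raise_if_subset[of "raised_set k v x" "raised_set k v y" k v]
      near_raise_if_subset[of "raised_set k v y" "raised_set k v x" k v]
      near_raise_imp_comparable[of "raised_set k v x" k "raised_set k v y" v]
      near_raise_imp_comparable[of "raised_set k v y" k "raised_set k v x" v]
      R[OF x] R[OF y] raise_raised_set[OF v x] raise_raised_set[OF v y]
    by auto
qed

section \<open>The isomorphism\<close>

text \<open>An order complex consists of the finite cliques of comparability, so a bijection
  matching the relations matches the faces.\<close>

lemma simplicial_iso_order_complexI: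
  assumes f: "bij_betw f V P"
    and K: "K = {\<sigma>. \<sigma> \<subseteq> V \<and> finite \<sigma> \<and> (\<forall>x\<in>\<sigma>. \<forall>y\<in>\<sigma>. R x y)}"
    and R: "\<And>x y. x \<in> V \<Longrightarrow> y \<in> V \<Longrightarrow> R x y \<longleftrightarrow> f x \<le> f y \<or> f y \<le> f x"
  shows "simplicial_iso K (order_complex P)"
proof -
  \<comment> \<open>Reflexivity of the order makes singletons faces, so every element of
    \<open>V\<close> is a vertex.\<close>
  have "{x} \<in> K" if "x \<in> V" for x
    using that R[OF that that] by (simp add: K)
  then have VK: "vertices K = V"
    unfolding vertices_def using K by blast
  have "{x} \<in> order_complex P" if "x \<in> P" for x
    using that by (simp add: order_complex_def chain_def)
  then have VP: "vertices (order_complex P) = P"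
    unfolding vertices_def by (auto simp: order_complex_def)
  have "\<sigma> \<in> K \<longleftrightarrow> f ` \<sigma> \<in> order_complex P" if \<sigma>: "\<sigma> \<subseteq> V" for \<sigma>
  proof -
    have "inj_on f \<sigma>" "f ` \<sigma> \<subseteq> P"
      using f \<sigma> by (auto simp: bij_betw_def inj_on_subset)
    moreover have "(\<forall>x\<in>\<sigma>. \<forall>y\<in>\<sigma>. R x y) \<longleftrightarrow> (\<forall>x\<in>\<sigma>. \<forall>y\<in>\<sigma>. f x \<le> f y \<or> f y \<le> f x)"
      using R \<sigma> by (meson subsetD)
    ultimately show ?thesis
      using \<sigma> by (auto simp: K order_complex_def chain_def finite_image_iff)
  qed
  then show ?thesis
    unfolding simplicial_iso_def VK VP using f by blast
qed

text \<open>The label 0 stands for the merged block of both walls, and the summand 1 counts index 0;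
  the other labels are the interior values in increasing order.\<close>

lemma vertex_type_block_sizes:
  assumes k: "k \<ge> 2" and q: "q \<ge> 1" and v: "v \<in> lattice_points k q"
    and type: "vertex_type k q v = (\<alpha>\<^sub>0, \<alpha>, \<alpha>\<^sub>s)"
  obtains cs where "distinct cs" "block q v ` {..<k} \<subseteq> set cs"
    "(\<alpha>\<^sub>0 + \<alpha>\<^sub>s + 1) # \<alpha> = map (\<lambda>c. card {j \<in> {..<k}. block q v j = c}) cs"
proof
  define C where "C = {c \<in> v ` {1..k-1}. 0 < c \<and> c < q}"
  let ?cs = "0 # sorted_list_of_set C"
  have fin: "finite C"
    by (simp add: C_def)
  note v0 = lattice_points_outside(1)[OF v]
  have vb: "0 \<le> v j" "v j \<le> q" for j
    using lattice_points_bounds[OF v] q by auto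
  have block: "block q v j = (if v j = q then 0 else v j)" for j
    using vb[of j] by (auto simp: block_def)
  show "distinct ?cs"
    using fin by (auto simp: C_def)
  have "block q v j \<in> insert 0 C" if "j < k" for j
  proof (cases "j = 0 \<or> v j = 0 \<or> v j = q")
    case True
    with v0 q show ?thesis
      by (auto simp: block)
  next
    case False
    with that vb[of j] have "v j \<in> C"
      by (auto simp: C_def)
    with False show ?thesis
      by (simp add: block)
  qed
  with fin show "block q v ` {..<k} \<subseteq> set ?cs"
    by auto
  have "{j \<in> {..<k}. block q v j = 0} =
      insert 0 ({j \<in> {1..k-1}. v j = 0} \<union> {j \<in> {1..k-1}. v j = q})"
    using k v0 q by (auto simp: block)
  \<comment> \<open>The walls differ because \<open>q \<ge> 1\<close>, so no coordinate is counted
    twice.\<close>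
  moreover have "card ({j \<in> {1..k-1}. v j = 0} \<union> {j \<in> {1..k-1}. v j = q}) =
      card {j \<in> {1..k-1}. v j = 0} + card {j \<in> {1..k-1}. v j = q}"
    using q by (intro card_Un_disjoint) auto
  ultimately have card0: "card {j \<in> {..<k}. block q v j = 0} = \<alpha>\<^sub>0 + \<alpha>\<^sub>s + 1"
    using type by (auto simp: vertex_type_def multiplicity_of_def)
  have "multiplicity_of k v c = card {j \<in> {..<k}. block q v j = c}" if "c \<in> C" for c
  proof -
    have "j \<in> {1..k-1} \<and> v j = c \<longleftrightarrow> j \<in> {..<k} \<and> block q v j = c" for j
      using that v0 k by (cases "j = 0") (auto simp: block C_def)
    then show ?thesis
      unfolding multiplicity_of_def by simp
  qed
  then have "map (multiplicity_of k v) (sorted_list_of_set C) =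
      map (\<lambda>c. card {j \<in> {..<k}. block q v j = c}) (sorted_list_of_set C)"
    using fin by (intro map_cong) auto
  moreover have "\<alpha> = map (multiplicity_of k v) (sorted_list_of_set C)"
    using type by (simp add: vertex_type_def C_def)
  ultimately show "(\<alpha>\<^sub>0 + \<alpha>\<^sub>s + 1) # \<alpha> = map (\<lambda>c. card {j \<in> {..<k}. block q v j = c}) ?cs"
    using card0 by (simp only: list.map)
qed

theorem mainTheorem2:
  fixes k :: nat and q :: int and v :: "nat \<Rightarrow> int"
    and \<alpha>\<^sub>0 \<alpha>\<^sub>s :: nat and \<alpha> :: "nat list"
  assumes "k \<ge> 2" and "q \<ge> 1"
    and "v \<in> lattice_points k q" and "v \<in> vertices (triangulation k q)"
    and "vertex_type k q v = (\<alpha>\<^sub>0, \<alpha>, \<alpha>\<^sub>s)"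
  shows "simplicial_iso (link (triangulation k q) {v})
           (order_complex (proper_part (chain_product ((\<alpha>\<^sub>0 + \<alpha>\<^sub>s + 1) # \<alpha>))))"
proof -
  note kqv = assms(1-3)
  obtain cs where cs: "distinct cs" "block q v ` {..<k} \<subseteq> set cs"
    "(\<alpha>\<^sub>0 + \<alpha>\<^sub>s + 1) # \<alpha> = map (\<lambda>c. card {j \<in> {..<k}. block q v j = c}) cs"
    using vertex_type_block_sizes[OF kqv assms(5)] .
  show ?thesis
  proof (rule simplicial_iso_order_complexI[OF _ link_eq_cliques[OF kqv]])
    \<comment> \<open>Neighbours pass to sets of raised indices, and these to vectors of block
      sizes.\<close>
    show "bij_betw (block_count (block q v) cs \<circ> raised_set k v) (neighbours k q v)
        (proper_part (chain_product ((\<alpha>\<^sub>0 + \<alpha>\<^sub>s + 1) # \<alpha>)))"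
      unfolding cs(3)
      using bij_betw_raised_set[OF kqv]
        bij_betw_block_count_proper_part[OF finite_lessThan inj_block_key cs(1,2)]
      by (rule bij_betw_trans)
    fix x y assume xy: "x \<in> neighbours k q v" "y \<in> neighbours k q v"
    show "near x y \<or> near y x \<longleftrightarrow>
        (block_count (block q v) cs \<circ> raised_set k v) x \<le> (block_count (block q v) cs \<circ> raised_set k v) y \<or>
        (block_count (block q v) cs \<circ> raised_set k v) y \<le> (block_count (block q v) cs \<circ> raised_set k v) x"
      unfolding near_iff_raised_set_comparable[OF kqv xy] o_apply
      using xy[THEN raised_set_in_raisable[OF kqv(2,3)]]
      by (simp only: block_count_le_iff[OF finite_lessThan inj_block_key cs(2)])
  qed
qed

end
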